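(* Let $\Lambda$ be the set of functions $\Psi$ of the form \[ \Psi(s)=bs-\int_0^\infty(1-e^{-sx})\,\mathrm dh(x),\qquad s\ge0, \] where $b\ge0$ and $h$ is a decreasing log-convex function on $(0,+\infty)$ satisfying $\int_0^1h(x)\,\mathrm dx<\infty$, $\int_0^\infty h(x)\,\mathrm dx=+\infty$ and $\lim_{x\to\infty}h(x)=0$. Then $\Lambda\subset\Sigma$.
   Context: A Bernstein function is a function $\Phi(s)=as+\int_{(0,\infty)}(1-e^{-sx})\lambda(\mathrm dx)$, $s\ge0$, with $a\ge0$ and $\lambda$ a measure on $(0,\infty)$ with $\int(x\wedge1)\lambda(\mathrm dx)<\infty$. For $\Phi\not\equiv0$, $\Phi^\ast(s)=s/\Phi(s)$ for $s>0$, $\Phi^\ast(0)=\lim_{s\to0}\Phi^\ast(s)$; $\Sigma$ is the set of Bernstein functions $\Phi\not\equiv0$ such that $\Phi^\ast$ is a Bernstein function. *)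

theory Defs
  imports "HOL-Analysis.Analysis"
begin

definition bernstein :: "(real \<Rightarrow> real) \<Rightarrow> bool" where
  "bernstein \<Phi> \<longleftrightarrow>
     (\<exists>a::real. a \<ge> 0 \<and>
       (\<exists>lam :: real measure.
          sets lam = sets borel \<and> emeasure lam {..0} = 0 \<and>
          integrable lam (\<lambda>x. min x 1) \<and>
          (\<forall>s\<ge>0. \<Phi> s = a * s + (\<integral>x. (1 - exp (- s * x)) \<partial>lam))))"

definition bstar :: "(real \<Rightarrow> real) \<Rightarrow> real \<Rightarrow> real" where
  "bstar \<Phi> s = (if s > 0 then s / \<Phi> s else Lim (at_right 0) (\<lambda>t. t / \<Phi> t))"

definition Sigma_set :: "(real \<Rightarrow> real) set" where
  "Sigma_set = {\<Phi>. bernstein \<Phi> \<and> (\<exists>s\<ge>0. \<Phi> s \<noteq> 0) \<and> bernstein (bstar \<Phi>)}"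

definition log_convex_pos :: "(real \<Rightarrow> real) \<Rightarrow> bool" where
  "log_convex_pos h \<longleftrightarrow> (\<forall>x>0. h x > 0) \<and> convex_on {0<..} (\<lambda>x. ln (h x))"

text \<open>The class \<Lambda>: \<Psi>(s) = b s - \<integral>_0^\<infinity> (1 - e^{-sx}) dh(x). Since h is decreasing,
  -dh is the positive Lebesgue--Stieltjes measure lam on (0,\<infinity>) with
  lam (x,y] = h x - h y; it is uniquely determined by these values.\<close>
definition Lambda_set :: "(real \<Rightarrow> real) set" where
  "Lambda_set = {\<Psi>. \<exists>b::real. \<exists>h::real \<Rightarrow> real.
      b \<ge> 0 \<and>
      (\<forall>x y. 0 < x \<longrightarrow> x \<le> y \<longrightarrow> h y \<le> h x) \<and>
      log_convex_pos h \<and>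
      (\<integral>\<^sup>+x\<in>{0<..1}. ennreal (h x) \<partial>lborel) < \<infinity> \<and>
      (\<integral>\<^sup>+x\<in>{0<..}. ennreal (h x) \<partial>lborel) = \<infinity> \<and>
      (h \<longlongrightarrow> 0) at_top \<and>
      (\<exists>lam :: real measure.
          sets lam = sets borel \<and> emeasure lam {..0} = 0 \<and>
          (\<forall>x y. 0 < x \<longrightarrow> x \<le> y \<longrightarrow> emeasure lam {x<..y} = ennreal (h x - h y)) \<and>
          (\<forall>s\<ge>0. \<Psi> s = b * s + (\<integral>x. (1 - exp (- s * x)) \<partial>lam)))}"

end

theory Submission
  imports Defs "HOL-Probability.Helly_Selection" "HOL-Probability.Probability_Mass_Function"
begin

text \<open>Integration by parts gives \<open>\<Psi> s = s * (b + H s)\<close> with \<open>H\<close> the Laplace transform of \<open>h\<close>, so the conjugate of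
  \<open>\<Psi>\<close> is \<open>1 / (b + H s)\<close>, which tends to \<open>0\<close> as \<open>s\<close> tends to \<open>0\<close>. Replace \<open>b + H\<close> by the power
  series in \<open>exp (- s * d)\<close> with coefficients \<open>b + d * h d, d * h (2 * d), d * h (3 * d), \<dots>\<close>, which form a
  log-convex sequence since \<open>b \<ge> 0\<close>. By Kaluza's theorem the reciprocal of this series has nonpositive
  coefficients beyond the constant one, so it is a Bernstein function with a discrete measure and possibly a
  killing term. As \<open>d\<close> tends to \<open>0\<close>, Helly's selection theorem, applied in the compact variable
  \<open>exp (- x)\<close>, yields a representing measure for \<open>1 / (b + H)\<close>: mass at \<open>x = 0\<close> becomes the drift, and
  there is no mass at \<open>x = \<infinity>\<close> because the limit vanishes at \<open>0\<close>.\<close>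

section \<open>Kaluza's theorem on reciprocals of log-convex power series\<close>

text \<open>Log-convexity makes the ratios \<open>r j\<close> increasing. Multiply the
  \<open>m\<close>-th convolution identity, whose value is 1 or 0, by \<open>r m\<close> and compare
  it termwise with the next one. Each factor \<open>u (Suc m - i)\<close> is only
  \<open>r (m - i)\<close> times \<open>u (m - i)\<close>, and since the earlier \<open>g i\<close>
  with \<open>i > 0\<close> are nonpositive, the smaller ratio raises the sum. The next identity is
  then solved for \<open>g (Suc m)\<close>.\<close>

lemma kaluza_inverse_fps_nonpos:
  fixes u :: "nat \<Rightarrow> real"
  assumes pos: "\<And>n. u n > 0" and lc: "\<And>n. (u (Suc n))\<^sup>2 \<le> u n * u (Suc (Suc n))"
  shows "fps_nth (inverse (Abs_fps u)) (Suc n) \<le> 0"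
proof (induction n rule: less_induct)
  case (less m)
  define g where "g = fps_nth (inverse (Abs_fps u))"
  define r where "r j = u (Suc j) / u j" for j
  have "incseq r"
    unfolding r_def by (intro incseq_SucI) (use pos lc in \<open>auto simp: field_simps power2_eq_square\<close>)
  have u0: "u 0 \<noteq> 0"
    using pos[of 0] by simp
  have conv: "(\<Sum>i=0..n. g i * u (n - i)) = (if n = 0 then 1 else 0)" for n
    using arg_cong[OF inverse_mult_eq_1[of "Abs_fps u"], of "\<lambda>F. fps_nth F n"] u0
    by (simp add: fps_mult_nth g_def)
  have "0 \<le> r m * (\<Sum>i=0..m. g i * u (m - i))"
    unfolding conv using pos by (simp add: r_def less_imp_le)
  also have "\<dots> = (\<Sum>i=0..m. r m * (g i * u (m - i)))"
    by (rule sum_distrib_left)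
  also have "\<dots> \<le> (\<Sum>i=0..m. g i * u (Suc m - i))"
  proof (rule sum_mono)
    fix i assume i: "i \<in> {0..m}"
    have eq: "g i * u (Suc m - i) = r (m - i) * (g i * u (m - i))"
      using i pos[of "m - i"] by (simp add: r_def Suc_diff_le)
    show "r m * (g i * u (m - i)) \<le> g i * u (Suc m - i)"
    proof (cases i)
      case 0
      then show ?thesis using pos[of m] by (simp add: r_def)
    next
      case (Suc j)
      then have "g i \<le> 0"
        using less[of j] i by (simp add: g_def)
      then have "g i * u (m - i) \<le> 0"
        using pos[of "m - i"] by (simp add: mult_le_0_iff)
      then show ?thesis
        unfolding eq using incseqD[OF \<open>incseq r\<close>, of "m - i" m] by (simp add: mult_right_mono_neg)
    qed
  qed
  also have "\<dots> = - (g (Suc m) * u 0)"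
    using conv[of "Suc m"] by simp
  finally show ?case
    using pos[of 0] by (simp add: g_def mult_le_0_iff)
qed

text \<open>The analytic form of Kaluza's theorem: the formal inverse converges on (0, 1), its
  coefficients have a nonnegative sum, and writing \<open>z ^ n\<close> as
  \<open>1 - (1 - z ^ n)\<close> turns the nonpositive coefficients into nonnegative
  weights.\<close>

lemma kaluza_reciprocal:
  fixes u :: "nat \<Rightarrow> real"
  assumes pos: "\<And>n. u n > 0" and lc: "\<And>n. (u (Suc n))\<^sup>2 \<le> u n * u (Suc (Suc n))"
    and summ: "\<And>z. 0 < z \<Longrightarrow> z < 1 \<Longrightarrow> summable (\<lambda>n. u n * z ^ n)"
  obtains p :: "nat \<Rightarrow> real" where "\<And>n. p n \<ge> 0"
    and "\<And>z. 0 < z \<Longrightarrow> z < 1 \<Longrightarrow>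
          (\<lambda>n. if n = 0 then p 0 else p n * (1 - z ^ n)) sums (1 / (\<Sum>n. u n * z ^ n))"
proof -
  define g where "g = fps_nth (inverse (Abs_fps u))"
  have u0: "u 0 \<noteq> 0"
    using pos[of 0] by simp
  have neg: "g (Suc n) \<le> 0" for n
    unfolding g_def by (rule kaluza_inverse_fps_nonpos[of u, OF pos lc])
  have g0: "g 0 = 1 / u 0"
    using u0 by (simp add: g_def field_simps)
  have conv: "(\<Sum>i\<le>n. g i * u (n - i)) = (if n = 0 then 1 else 0)" for n
    using arg_cong[OF inverse_mult_eq_1[of "Abs_fps u"], of "\<lambda>F. fps_nth F n"] u0
    by (simp add: fps_mult_nth g_def atLeast0AtMost)
  have bound: "\<bar>g n\<bar> \<le> u n / (u 0)\<^sup>2" for n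
  proof (cases n)
    case 0
    then show ?thesis using pos[of 0] by (simp add: g0 power2_eq_square)
  next
    case (Suc m)
    \<comment> \<open>The convolution at \<open>Suc m\<close> vanishes. Apart from its two end terms
      all summands are nonpositive, and dropping them leaves
      \<open>0 \<le> g 0 * u (Suc m) + g (Suc m) * u 0\<close>.\<close>
    have "0 = g 0 * u (Suc m) + (\<Sum>i\<le>m. g (Suc i) * u (m - i))"
      using conv[of "Suc m"] by (subst (asm) sum.atMost_Suc_shift) simp
    also have "(\<Sum>i\<le>m. g (Suc i) * u (m - i)) \<le> (\<Sum>i\<in>{m}. g (Suc i) * u (m - i))"
    proof -
      have "(\<Sum>i\<in>{..m} - {m}. g (Suc i) * u (m - i)) \<le> 0"
        by (intro sum_nonpos) (use neg pos in \<open>auto simp: mult_le_0_iff less_imp_le\<close>)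
      then show ?thesis by (simp add: sum_diff1)
    qed
    finally show ?thesis
      using neg[of m] pos[of 0] by (simp add: Suc g0 field_simps power2_eq_square)
  qed
  have gsumm: "summable (\<lambda>n. \<bar>g n * z ^ n\<bar>)" if z: "0 < z" "z < 1" for z
  proof (rule summable_comparison_test')
    show "summable (\<lambda>n. u n * z ^ n / (u 0)\<^sup>2)"
      by (rule summable_divide[OF summ[OF z]])
    show "norm \<bar>g n * z ^ n\<bar> \<le> u n * z ^ n / (u 0)\<^sup>2" for n
      using mult_right_mono[OF bound[of n], of "z ^ n"] z by (simp add: abs_mult)
  qed
  have prod: "(\<Sum>n. g n * z ^ n) * (\<Sum>n. u n * z ^ n) = 1" if z: "0 < z" "z < 1" for z
  proof -
    have "(\<Sum>n. g n * z ^ n) * (\<Sum>n. u n * z ^ n)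
        = (\<Sum>k. \<Sum>i\<le>k. (g i * z ^ i) * (u (k - i) * z ^ (k - i)))"
      by (rule Cauchy_product) (use gsumm[OF z] summ[OF z] pos z in \<open>simp_all add: abs_mult less_imp_le\<close>)
    also have "(\<lambda>k. \<Sum>i\<le>k. (g i * z ^ i) * (u (k - i) * z ^ (k - i))) = (\<lambda>k. if k = 0 then 1 else 0)"
    proof
      fix k
      have "(\<Sum>i\<le>k. (g i * z ^ i) * (u (k - i) * z ^ (k - i))) = (\<Sum>i\<le>k. (g i * u (k - i)) * z ^ k)"
        by (intro sum.cong) (simp_all flip: power_add add: mult_ac)
      also have "\<dots> = (if k = 0 then 1 else 0)"
        by (simp flip: sum_distrib_right add: conv)
      finally show "(\<Sum>i\<le>k. (g i * z ^ i) * (u (k - i) * z ^ (k - i))) = (if k = 0 then 1 else 0)" .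
    qed
    also have "(\<Sum>k. if k = 0 then 1 else 0) = (1::real)"
      using suminf_finite[of "{0::nat}" "\<lambda>k. if k = 0 then 1 else 0 :: real"] by simp
    finally show ?thesis .
  qed
  have Upos: "(\<Sum>n. u n * z ^ n) > 0" if z: "0 < z" "z < 1" for z
    by (rule suminf_pos[OF summ[OF z]]) (use pos z in auto)
  \<comment> \<open>The whole series is positive, being the reciprocal of a positive one, and the
    tail cut off is nonpositive; so the partial sum is at least the whole.\<close>
  have part: "0 \<le> (\<Sum>n\<le>N. g n * z ^ n)" if z: "0 < z" "z < 1" for z N
  proof -
    have "0 \<le> (\<Sum>n. g n * z ^ n)"
      using prod[OF z] Upos[OF z] by (metis less_eq_real_def zero_less_mult_pos2 zero_less_one)
    also have "\<dots> = (\<Sum>n. g (n + Suc N) * z ^ (n + Suc N)) + (\<Sum>n<Suc N. g n * z ^ n)"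
      by (rule suminf_split_initial_segment) (rule summable_rabs_cancel[OF gsumm[OF z]])
    also have "(\<Sum>n. g (n + Suc N) * z ^ (n + Suc N)) \<le> 0"
    proof (rule suminf_le_const)
      show "summable (\<lambda>n. g (n + Suc N) * z ^ (n + Suc N))"
        by (rule summable_ignore_initial_segment[OF summable_rabs_cancel[OF gsumm[OF z]]])
      show "(\<Sum>n<k. g (n + Suc N) * z ^ (n + Suc N)) \<le> 0" for k
        by (intro sum_nonpos) (use neg z in \<open>auto simp: mult_le_0_iff\<close>)
    qed
    finally show ?thesis by (simp add: lessThan_Suc_atMost)
  qed
  \<comment> \<open>The finite sum allows \<open>z\<close> to tend to 1 before anything is known
    about convergence at 1.\<close>
  have part1: "0 \<le> (\<Sum>n\<le>N. g n)" for N
  proof -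
    have "((\<lambda>z. \<Sum>n\<le>N. g n * z ^ n) \<longlongrightarrow> (\<Sum>n\<le>N. g n * 1 ^ n)) (at_left 1)"
      by (intro tendsto_intros)
    moreover have "\<forall>\<^sub>F z in at_left 1. 0 \<le> (\<Sum>n\<le>N. g n * z ^ n)"
      by (rule eventually_mono[OF eventually_at_left_real[of 0 1]]) (use part in auto)
    ultimately show ?thesis
      using tendsto_lowerbound[of "\<lambda>z. \<Sum>n\<le>N. g n * z ^ n" "\<Sum>n\<le>N. g n * 1 ^ n" "at_left (1::real)" 0] by simp
  qed
  \<comment> \<open>The bound on partial sums says that the terms \<open>- g (Suc i)\<close> never
    add up to more than \<open>g 0\<close>.\<close>
  have summ1: "summable g"
  proof -
    have "summable (\<lambda>n. - g (Suc n))"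
    proof (rule summableI_nonneg_bounded)
      show "(\<Sum>i<n. - g (Suc i)) \<le> g 0" for n
        using part1[of n] sum.atMost_shift[of g n] by (simp add: sum_negf)
    qed (use neg in auto)
    then show ?thesis
      by (simp add: summable_minus_iff summable_Suc_iff)
  qed
  \<comment> \<open>\<open>p 0\<close> is the total of all coefficients. It collects the constants
    left over when each \<open>g n * z ^ n\<close> is split as
    \<open>g n - g n * (1 - z ^ n)\<close>.\<close>
  define p where "p n = (if n = 0 then suminf g else - g n)" for n
  show thesis
  proof (rule that[of p])
    show "p n \<ge> 0" for n
    proof (cases n)
      case 0
      have "(\<lambda>N. \<Sum>n\<le>N. g n) \<longlonglongrightarrow> suminf g"
        using summable_LIMSEQ'[OF summ1] by (simp add: lessThan_Suc_atMost)
      then show ?thesis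
        using part1 LIMSEQ_le_const by (fastforce simp: p_def 0)
    next
      case (Suc m)
      then show ?thesis using neg[of m] by (simp add: p_def)
    qed
    fix z :: real assume z: "0 < z" "z < 1"
    have inv: "(\<Sum>n. g n * z ^ n) = 1 / (\<Sum>n. u n * z ^ n)"
      using prod[OF z] Upos[OF z] by (simp add: field_simps)
    have "(\<lambda>n. - g n * (1 - z ^ n)) = (\<lambda>n. g n * z ^ n - g n)"
      by (auto simp: algebra_simps)
    then have "(\<lambda>n. - g n * (1 - z ^ n)) sums ((\<Sum>n. g n * z ^ n) - suminf g)"
      by (simp only:) (intro sums_diff summable_sums summ1 summable_rabs_cancel[OF gsumm[OF z]])
    from sums_add[OF sums_single[of 0 "\<lambda>_. suminf g"] this]
    have "(\<lambda>n. (if n = 0 then suminf g else 0) + - g n * (1 - z ^ n)) sums (1 / (\<Sum>n. u n * z ^ n))"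
      by (simp add: inv)
    also have "(\<lambda>n. (if n = 0 then suminf g else 0) + - g n * (1 - z ^ n))
        = (\<lambda>n. if n = 0 then p 0 else p n * (1 - z ^ n))"
      by (auto simp: p_def)
    finally show "(\<lambda>n. if n = 0 then p 0 else p n * (1 - z ^ n)) sums (1 / (\<Sum>n. u n * z ^ n))" .
  qed
qed

section \<open>Bernstein functions as integrals over the unit interval\<close>

text \<open>Under the substitution \<open>y = exp (- x)\<close> this is \<open>(1 - exp (- s * x)) / (1 - exp (- x))\<close>, continued to
  \<open>x = 0\<close> and \<open>x = \<infinity>\<close>; clamping to the unit interval makes it a bounded continuous function on the whole
  line.\<close>
definition bern_kernel :: "real \<Rightarrow> real \<Rightarrow> real" where
  "bern_kernel s y = (let c = max 0 (min 1 y) in if c = 1 then s else (1 - c powr s) / (1 - c))"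

lemma bern_kernel_0: "y \<le> 0 \<Longrightarrow> bern_kernel s y = 1"
  and bern_kernel_1: "y \<ge> 1 \<Longrightarrow> bern_kernel s y = s"
  and bern_kernel_mid: "0 < y \<Longrightarrow> y < 1 \<Longrightarrow> bern_kernel s y = (1 - y powr s) / (1 - y)"
  by (auto simp: bern_kernel_def Let_def)

lemma bern_kernel_nonneg:
  assumes "s > 0" shows "0 \<le> bern_kernel s y"
proof -
  consider "y \<le> 0" | "0 < y" "y < 1" | "y \<ge> 1" by linarith
  then show ?thesis
    using assms powr_le1[of s y] by cases (simp_all add: bern_kernel_0 bern_kernel_1 bern_kernel_mid)
qed

lemma continuous_on_bern_kernel:
  assumes s: "s > 0"
  shows "continuous_on UNIV (bern_kernel s)"
proof -
  define q where "q c = (if c = 1 then s else (1 - c powr s) / (1 - c))" for c :: real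
  have "continuous_on {0..1} q"
    unfolding continuous_on_def
  proof
    fix x :: real assume x: "x \<in> {0..1}"
    show "(q \<longlongrightarrow> q x) (at x within {0..1})"
    proof (cases "x = 1")
      case False
      \<comment> \<open>At \<open>x = 0\<close> this uses \<open>0 powr s = 0\<close> and the
        continuity of the power there for \<open>s > 0\<close>.\<close>
      have "((\<lambda>c. (1 - c powr s) / (1 - c)) \<longlongrightarrow> (1 - x powr s) / (1 - x)) (at x within {0..1})"
        using x False s by (intro tendsto_intros tendsto_powr')
          (auto simp: eventually_at_filter intro!: always_eventually)
      moreover have "\<forall>\<^sub>F c in at x within {0..1}. (1 - c powr s) / (1 - c) = q c"
        using eventually_mono[OF t1_space_nhds[OF False]] by (auto simp: q_def eventually_at_filter)
      ultimately show ?thesis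
        using False by (auto simp: q_def intro: Lim_transform_eventually)
    next
      case True
      \<comment> \<open>At 1 the kernel is the difference quotient of \<open>c powr s\<close>, so
        the value prescribed there is the derivative \<open>s\<close>.\<close>
      have "((\<lambda>z. z powr s) has_real_derivative s) (at 1 within {0..1})"
        by (rule DERIV_subset[of _ _ _ UNIV]) (auto intro!: derivative_eq_intros)
      then have "((\<lambda>c. (c powr s - 1 powr s) / (c - 1)) \<longlongrightarrow> s) (at 1 within {0..1})"
        by (simp add: has_field_derivative_iff)
      moreover have "\<forall>\<^sub>F c in at 1 within {0..1}. (c powr s - 1 powr s) / (c - 1) = q c"
        by (auto simp: q_def eventually_at_filter divide_simps algebra_simps intro!: always_eventually)
      ultimately show ?thesis
        using True by (auto simp: q_def intro: Lim_transform_eventually)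
    qed
  qed
  then have "continuous_on UNIV (\<lambda>y. q (max 0 (min 1 y)))"
    by (rule continuous_on_compose2) (auto intro!: continuous_intros)
  then show ?thesis
    by (simp add: bern_kernel_def q_def Let_def cong: if_cong)
qed

lemma bounded_bern_kernel:
  assumes s: "s > 0"
  obtains B where "\<And>y. \<bar>bern_kernel s y\<bar> \<le> B"
proof -
  have "compact (bern_kernel s ` {0..1})"
    using continuous_on_subset[OF continuous_on_bern_kernel[OF s]] by (intro compact_continuous_image) auto
  then obtain B where B: "\<And>y. y \<in> {0..1} \<Longrightarrow> \<bar>bern_kernel s y\<bar> \<le> B"
    by (fastforce dest: compact_imp_bounded simp: bounded_iff)
  have "\<bar>bern_kernel s y\<bar> \<le> B" for y
    using B[of "max 0 (min 1 y)"] by (simp add: bern_kernel_def)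
  then show thesis by (rule that)
qed

text \<open>Measures carried by one compact interval are tight, so Helly's theorem gives a weakly
  convergent subsequence. Convergence against bounded continuous functions is all that is needed of
  it.\<close>

lemma weak_limit_unit_interval:
  fixes N :: "nat \<Rightarrow> real measure"
  assumes N: "\<And>k. real_distribution (N k)" and supp: "\<And>k. measure (N k) {0..1} = 1"
  obtains r M where "strict_mono (r :: nat \<Rightarrow> nat)" "real_distribution M"
    "\<And>f B. continuous_on UNIV f \<Longrightarrow> (\<And>x. \<bar>f x\<bar> \<le> B) \<Longrightarrow> (\<lambda>k. \<integral>x. f x \<partial>N (r k)) \<longlonglongrightarrow> (\<integral>x. f x \<partial>M :: real)"
proof -
  have "tight N"
    unfolding tight_def
  proof (intro conjI allI impI N)
    fix e :: real assume "e > 0"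
    \<comment> \<open>Tightness asks for a half-open interval, so the left end is moved below 0 to
      keep an atom at 0.\<close>
    have "measure (N k) {-1<..1} > 1 - e" for k
    proof -
      interpret real_distribution "N k" by (rule N)
      have "measure (N k) {0..1} \<le> measure (N k) {-1<..1}"
        by (rule finite_measure_mono) auto
      then show ?thesis using supp[of k] \<open>e > 0\<close> by simp
    qed
    then show "\<exists>a b. a < b \<and> (\<forall>n. 1 - e < measure (N n) {a<..b})"
      by (intro exI[of _ "-1"] exI[of _ 1]) auto
  qed
  from tight_imp_convergent_subsubsequence[OF this strict_mono_id]
  obtain r M where r: "strict_mono r" "real_distribution M" "weak_conv_m (N \<circ> id \<circ> r) M"
    by auto
  show thesis
  proof (rule that[OF r(1,2)])
    fix f :: "real \<Rightarrow> real" and B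
    assume f: "continuous_on UNIV f" "\<And>x. \<bar>f x\<bar> \<le> B"
    interpret M: real_distribution M by (rule r)
    interpret N: real_distribution "(N \<circ> id \<circ> r) k" for k by (simp add: N)
    show "(\<lambda>k. \<integral>x. f x \<partial>N (r k)) \<longlonglongrightarrow> (\<integral>x. f x \<partial>M)"
      using weak_conv_imp_integral_bdd_continuous_conv[of "N \<circ> id \<circ> r" M f B] r N f
      by (simp add: continuous_on_eq_continuous_at)
  qed
qed

text \<open>Transfers integrability from \<open>1 - exp (- x)\<close> to \<open>min x 1\<close>.
  Both are compared with \<open>x / (1 + x)\<close>.\<close>

lemma one_minus_exp_lower:
  fixes x :: real
  assumes "x \<ge> 0" shows "min x 1 \<le> 2 * (1 - exp (- x))"
proof -
  have "exp (- x) \<le> 1 / (1 + x)"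
    using assms exp_ge_add_one_self[of x] by (simp add: exp_minus field_simps)
  then have "2 * (x / (1 + x)) \<le> 2 * (1 - exp (- x))"
    using assms by (simp add: field_simps)
  moreover have "min x 1 \<le> 2 * (x / (1 + x))"
  proof (cases "x \<le> 1")
    case True
    then show ?thesis
      using assms mult_right_mono[of x 1 x] by (simp add: field_simps)
  qed (use assms in \<open>simp add: field_simps\<close>)
  ultimately show ?thesis by (rule order.trans[rotated])
qed

text \<open>Undoes the substitution \<open>y = exp (- x)\<close>. Mass on \<open>{1..}\<close>,
  where the kernel is \<open>s\<close>, becomes the drift. Mass on \<open>{0<..<1}\<close> becomes
  the measure on the half-line. Mass on \<open>{..0}\<close>, where the kernel is 1, would be a
  constant term, which the limit at 0 excludes.\<close>

lemma bernstein_bern_kernel_integral: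
  assumes M: "real_distribution M" and c: "c \<ge> 0"
    and phi: "\<And>s. s > 0 \<Longrightarrow> \<phi> s = c * (\<integral>y. bern_kernel s y \<partial>M)"
    and phi0: "\<phi> 0 = 0" and lim: "(\<phi> \<longlongrightarrow> 0) (at_right 0)"
  shows "bernstein \<phi>"
proof (cases "c = 0")
  case True
  then show ?thesis
    unfolding bernstein_def
    by (intro exI[of _ 0] conjI exI[of _ "null_measure borel"] allI impI)
       (use phi phi0 in \<open>force simp: order_le_less\<close>)+
next
  case False
  with c have c: "c > 0" by simp
  interpret real_distribution M by (rule M)
  have meas [measurable]: "bern_kernel s \<in> borel_measurable borel" if "s > 0" for s
    by (rule borel_measurable_continuous_onI[OF continuous_on_bern_kernel[OF that]])
  have int: "integrable M (bern_kernel s)" if s: "s > 0" for s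
  proof -
    obtain B where "\<And>y. \<bar>bern_kernel s y\<bar> \<le> B"
      using bounded_bern_kernel[OF s] by blast
    then show ?thesis
      using meas[OF s] by (intro integrable_const_bound[of _ B]) auto
  qed
  \<comment> \<open>The kernel equals 1 on \<open>{..0}\<close> for every \<open>s\<close>, so
    \<open>c * prob {..0}\<close> is a lower bound for \<open>\<phi> s\<close> that does not depend
    on \<open>s\<close>.\<close>
  have null: "prob {..0} = 0"
  proof -
    have "c * prob {..0} \<le> \<phi> s" if "s > 0" for s
    proof -
      have "prob {..0} = (\<integral>y. indicator {..0} y \<partial>M)"
        by simp
      also have "\<dots> \<le> (\<integral>y. bern_kernel s y \<partial>M)"
        by (intro integral_mono int that)
          (auto simp: bern_kernel_nonneg that bern_kernel_0 less_top[symmetric] intro!: integrable_real_indicator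
            split: split_indicator)
      finally show ?thesis using c phi[OF that] by simp
    qed
    then have "c * prob {..0} \<le> 0"
      by (intro tendsto_lowerbound[OF lim]) (auto simp: eventually_at_filter)
    then show ?thesis
      using c measure_nonneg[of M "{..0}"] by (simp add: mult_le_0_iff)
  qed
  \<comment> \<open>The density cancels the denominator \<open>1 - y\<close> of the kernel; the
    indicator removes both end points, which are treated separately.\<close>
  define w where "w y = indicator {0<..<1} y * (c / (1 - y))" for y :: real
  have w: "w y \<ge> 0" for y
    using c by (simp add: w_def split: split_indicator)
  have [measurable]: "w \<in> borel_measurable borel"
    unfolding w_def by measurable
  define lam where "lam = distr (density M (\<lambda>y. ennreal (w y))) borel (\<lambda>y. - ln y)"
  have lam_int: "integrable lam f \<longleftrightarrow> integrable M (\<lambda>y. w y * f (- ln y))"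
    and lam_integral: "(\<integral>x. f x \<partial>lam) = (\<integral>y. w y * f (- ln y) \<partial>M)"
    if [measurable]: "f \<in> borel_measurable borel" for f :: "real \<Rightarrow> real"
    unfolding lam_def using w
    by (simp_all add: integrable_distr_eq integral_distr integrable_density integral_density)
  have w_exp: "w y * (1 - exp (- s * (- ln y))) = c * (bern_kernel s y * indicator {0<..<1} y)" for s y
    by (auto simp: w_def bern_kernel_mid powr_def split: split_indicator)
  have int_exp: "integrable lam (\<lambda>x. 1 - exp (- s * x))" if "s > 0" for s
  proof (subst lam_int)
    show "integrable M (\<lambda>y. w y * (1 - exp (- s * (- ln y))))"
      unfolding w_exp using int[OF that] by (intro integrable_mult_right integrable_real_mult_indicator) auto
  qed simp
  have "integrable lam (\<lambda>x. min x 1)"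
  proof (rule Bochner_Integration.integrable_bound)
    show "integrable lam (\<lambda>x. 2 * (1 - exp (- 1 * x)))"
      by (intro integrable_mult_right int_exp) simp
    have "AE y in density M (\<lambda>y. ennreal (w y)). 0 \<le> - ln y"
      by (subst AE_density) (auto simp: w_def split: split_indicator_asm)
    then have "AE x in lam. 0 \<le> x"
      unfolding lam_def by (subst AE_distr_iff) auto
    then show "AE x in lam. norm (min x 1) \<le> norm (2 * (1 - exp (- 1 * x)))"
      by eventually_elim (use one_minus_exp_lower in auto)
  qed (simp add: lam_def)
  moreover have "emeasure lam {..0} = 0"
  proof -
    have "emeasure lam {..0} = (\<integral>\<^sup>+y. ennreal (w y) * indicator ((\<lambda>y. - ln y) -` {..0}) y \<partial>M)"
      unfolding lam_def
      by (simp add: emeasure_distr emeasure_density measurable_sets_borel[of "\<lambda>y::real. - ln y" borel])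
    also have "\<dots> = (\<integral>\<^sup>+y. 0 \<partial>M)"
      by (intro nn_integral_cong) (auto simp: w_def split: split_indicator)
    finally show ?thesis by simp
  qed
  moreover have "\<phi> s = c * prob {1..} * s + (\<integral>x. (1 - exp (- s * x)) \<partial>lam)" if "s \<ge> 0" for s
  proof (cases "s = 0")
    case True
    then show ?thesis using phi0 by simp
  next
    case False
    with that have s: "s > 0" by simp
    have ae: "AE y in M. \<not> y \<le> 0"
      using null by (subst AE_iff_measurable[of "{..0}"]) (auto simp: emeasure_eq_measure)
    have "(\<integral>y. bern_kernel s y \<partial>M) = (\<integral>y. s * indicator {1..} y + bern_kernel s y * indicator {0<..<1} y \<partial>M)"
    proof (rule integral_cong_AE)
      show "AE y in M. bern_kernel s y = s * indicator {1..} y + bern_kernel s y * indicator {0<..<1} y"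
        using ae by eventually_elim (auto simp: bern_kernel_1 split: split_indicator)
    qed (use meas[OF s] in auto)
    also have "\<dots> = s * prob {1..} + (\<integral>y. bern_kernel s y * indicator {0<..<1} y \<partial>M)"
      using int[OF s] by (subst Bochner_Integration.integral_add)
        (auto intro!: integrable_real_mult_indicator integrable_real_indicator simp: less_top[symmetric])
    finally show ?thesis
      by (subst lam_integral) (simp_all only: w_exp, simp_all add: phi[OF s] algebra_simps)
  qed
  ultimately show ?thesis
    unfolding bernstein_def using c
    by (intro exI[of _ "c * prob {1..}"] conjI exI[of _ lam]) (auto simp: lam_def)
qed

text \<open>The term with weight \<open>p n\<close> is an atom at \<open>x = n * d\<close>, that is
  at \<open>y = exp (- d) ^ n\<close>. Multiplying the weight by \<open>1 - exp (- d) ^ n\<close>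
  compensates the denominator of the kernel. The new weights add up to the series at
  \<open>s = 1\<close>, so division by \<open>\<phi> 1\<close> makes them a probability
  distribution.\<close>

lemma discrete_bern_kernel_measure:
  fixes p :: "nat \<Rightarrow> real"
  assumes p: "\<And>n. p n \<ge> 0" and d: "d > 0" and phi1: "\<phi> 1 > 0"
    and sums: "\<And>s. s > 0 \<Longrightarrow> (\<lambda>n. if n = 0 then p 0 else p n * (1 - exp (- s * d) ^ n)) sums \<phi> s"
  obtains N where "real_distribution N" "measure N {0..1} = 1"
    "\<And>s. s > 0 \<Longrightarrow> (\<integral>y. bern_kernel s y \<partial>N) = \<phi> s / \<phi> 1"
proof -
  define q where "q n = (if n = 0 then p 0 else p n * (1 - exp (- 1 * d) ^ n)) / \<phi> 1" for n
  \<comment> \<open>The constant term \<open>p 0\<close> is placed at \<open>y = 0\<close>, which is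
    \<open>x = \<infinity>\<close>, and not at \<open>exp (- d) ^ 0 = 1\<close>: the kernel must be
    1 there.\<close>
  define y where "y n = (if n = 0 then 0 else exp (- d) ^ n)" for n :: nat
  have q: "q n \<ge> 0" for n
    using p[of n] p[of 0] d phi1 by (auto simp: q_def power_le_one)
  have "q sums 1"
    unfolding q_def using sums_divide[OF sums[of 1], of "\<phi> 1"] phi1 by simp
  then have "(\<integral>\<^sup>+n. ennreal (q n) \<partial>count_space UNIV) = 1"
    using q by (simp add: nn_integral_count_space_nat suminf_ennreal2 sums_iff)
  then have pmf: "pmf (embed_pmf q) n = q n" for n
    by (intro pmf_embed_pmf q)
  define N where "N = distr (measure_pmf (embed_pmf q)) borel y"
  have dist: "real_distribution N"
    unfolding N_def by (intro real_distribution.intro measure_pmf.prob_space_distr real_distribution_axioms.intro) auto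
  show thesis
  proof (rule that[OF dist])
    have "y -` {0..1} = UNIV"
      using d by (auto simp: y_def power_le_one)
    then show "measure N {0..1} = 1"
      unfolding N_def by (subst measure_distr) (auto simp: measure_pmf.prob_space[simplified])
    fix s :: real assume s: "s > 0"
    have term_eq: "q n * bern_kernel s (y n) = (if n = 0 then p 0 else p n * (1 - exp (- s * d) ^ n)) / \<phi> 1" for n
    proof (cases "n = 0")
      case False
      have lt: "exp (- d) ^ n < 1"
        using d False by (simp add: power_less_one_iff)
      have "(exp (- d) ^ n) powr s = exp (- s * d) ^ n"
        by (simp add: powr_def ln_realpow exp_of_nat_mult[symmetric] mult_ac)
      then show ?thesis
        using False lt by (simp add: q_def y_def bern_kernel_mid)
    qed (simp add: q_def y_def bern_kernel_0)
    have nonneg: "0 \<le> q n * bern_kernel s (y n)" for n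
      using q bern_kernel_nonneg[OF s] by simp
    have sm: "(\<lambda>n. q n * bern_kernel s (y n)) sums (\<phi> s / \<phi> 1)"
      unfolding term_eq by (rule sums_divide[OF sums[OF s]])
    have "(\<integral>y. bern_kernel s y \<partial>N) = (\<integral>n. bern_kernel s (y n) \<partial>measure_pmf (embed_pmf q))"
      unfolding N_def
      by (rule integral_distr) (auto intro: borel_measurable_continuous_onI[OF continuous_on_bern_kernel[OF s]])
    also have "\<dots> = (\<integral>n. q n * bern_kernel s (y n) \<partial>count_space UNIV)"
      unfolding measure_pmf_eq_density pmf by (subst integral_density) (use q in auto)
    also have "\<dots> = (\<Sum>n. q n * bern_kernel s (y n))"
      by (rule integral_count_space_nat) (use sm nonneg in \<open>auto simp: integrable_count_space_nat_iff sums_iff\<close>)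
    also have "\<dots> = \<phi> s / \<phi> 1"
      using sm by (simp add: sums_iff)
    finally show "(\<integral>y. bern_kernel s y \<partial>N) = \<phi> s / \<phi> 1" .
  qed
qed

text \<open>Each approximant, normalised by its value at 1, is a kernel integral against a
  probability measure on the unit interval. The kernel is bounded and continuous, so a weak limit of
  a subsequence represents \<open>\<phi> s / \<phi> 1\<close>.\<close>

lemma bernstein_limit:
  fixes \<phi> :: "real \<Rightarrow> real" and p :: "nat \<Rightarrow> nat \<Rightarrow> real"
  assumes p: "\<And>k n. p k n \<ge> 0" and d: "\<And>k. d k > 0"
    and pos: "\<And>k. \<phi>k k 1 > 0" "\<phi> 1 > 0"
    and sums: "\<And>k s. s > 0 \<Longrightarrow> (\<lambda>n. if n = 0 then p k 0 else p k n * (1 - exp (- s * d k) ^ n)) sums \<phi>k k s"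
    and conv: "\<And>s. s > 0 \<Longrightarrow> (\<lambda>k. \<phi>k k s) \<longlonglongrightarrow> \<phi> s"
    and phi0: "\<phi> 0 = 0" and lim: "(\<phi> \<longlongrightarrow> 0) (at_right 0)"
  shows "bernstein \<phi>"
proof -
  have "\<exists>N. real_distribution N \<and> measure N {0..1} = 1 \<and>
      (\<forall>s>0. (\<integral>y. bern_kernel s y \<partial>N) = \<phi>k k s / \<phi>k k 1)" for k
    using discrete_bern_kernel_measure[of "p k" "d k" "\<phi>k k", OF p d pos(1) sums] by metis
  then obtain N where N: "\<And>k. real_distribution (N k)" "\<And>k. measure (N k) {0..1} = 1"
    and ker: "\<And>k s. s > 0 \<Longrightarrow> (\<integral>y. bern_kernel s y \<partial>N k) = \<phi>k k s / \<phi>k k 1"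
    by metis
  obtain r M where r: "strict_mono (r :: nat \<Rightarrow> nat)" and M: "real_distribution M"
    and weak: "\<And>f B. continuous_on UNIV f \<Longrightarrow> (\<And>x. \<bar>f x\<bar> \<le> B) \<Longrightarrow>
        (\<lambda>k. \<integral>x. f x \<partial>N (r k)) \<longlonglongrightarrow> (\<integral>x. f x \<partial>M :: real)"
    using weak_limit_unit_interval[of N, OF N] by blast
  show ?thesis
  proof (rule bernstein_bern_kernel_integral[OF M _ _ phi0 lim])
    show "\<phi> 1 \<ge> 0"
      using pos by simp
    fix s :: real assume s: "s > 0"
    obtain B where B: "\<And>y. \<bar>bern_kernel s y\<bar> \<le> B"
      using bounded_bern_kernel[OF s] by blast
    have "(\<lambda>k. \<phi>k k s / \<phi>k k 1) \<longlonglongrightarrow> \<phi> s / \<phi> 1"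
      using s pos by (intro tendsto_divide conv) auto
    from LIMSEQ_subseq_LIMSEQ[OF this r]
    have "(\<lambda>k. \<integral>x. bern_kernel s x \<partial>N (r k)) \<longlonglongrightarrow> \<phi> s / \<phi> 1"
      by (simp add: ker s o_def)
    with weak[OF continuous_on_bern_kernel[OF s] B] have "(\<integral>x. bern_kernel s x \<partial>M) = \<phi> s / \<phi> 1"
      by (rule LIMSEQ_unique)
    then show "\<phi> s = \<phi> 1 * (\<integral>x. bern_kernel s x \<partial>M)"
      using pos by simp
  qed
qed

section \<open>Log-convex tails and their Laplace transform\<close>

lemma log_convex_pos_continuous_on:
  assumes "log_convex_pos h"
  shows "continuous_on {0<..} h"
proof -
  have "continuous_on {0<..} (\<lambda>x. exp (ln (h x)))"
    using assms by (intro continuous_on_exp convex_on_continuous) (auto simp: log_convex_pos_def)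
  then show ?thesis
    using assms by (subst continuous_on_cong[where g = "\<lambda>x. exp (ln (h x))"]) (auto simp: log_convex_pos_def)
qed

text \<open>For equally spaced arguments this is the hypothesis of Kaluza's theorem.\<close>

lemma log_convex_pos_midpoint:
  assumes h: "log_convex_pos h" and xy: "x > 0" "y > 0"
  shows "(h ((x + y) / 2))\<^sup>2 \<le> h x * h y"
proof -
  have pos: "h x > 0" "h y > 0" "h ((x + y) / 2) > 0"
    using h xy by (auto simp: log_convex_pos_def)
  have "ln (h ((1 - 1/2) *\<^sub>R x + (1/2) *\<^sub>R y)) \<le> (1 - 1/2) * ln (h x) + 1/2 * ln (h y)"
    using h xy by (intro convex_onD[of "{0<..}" "\<lambda>x. ln (h x)"]) (auto simp: log_convex_pos_def)
  also have "(1 - 1/2) *\<^sub>R x + (1/2) *\<^sub>R y = (x + y) / 2"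
    by (simp add: field_simps)
  finally have "ln ((h ((x + y) / 2))\<^sup>2) \<le> ln (h x * h y)"
    using pos by (simp add: ln_mult ln_realpow)
  then show ?thesis
    using pos by simp
qed

text \<open>Here \<open>lam\<close> is the Stieltjes measure of \<open>-h\<close>. Of log-convexity
  only its consequences, positivity and continuity, are recorded; the full property enters later
  through Kaluza's theorem.\<close>

locale decreasing_tail =
  fixes h :: "real \<Rightarrow> real" and lam :: "real measure"
  assumes antimono: "0 < x \<Longrightarrow> x \<le> y \<Longrightarrow> h y \<le> h x"
    and pos: "x > 0 \<Longrightarrow> h x > 0"
    and cont: "continuous_on {0<..} h"
    and int_small: "(\<integral>\<^sup>+x\<in>{0<..1}. ennreal (h x) \<partial>lborel) < \<infinity>"
    and lim_top: "(h \<longlongrightarrow> 0) at_top"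
    and sets_lam [measurable_cong, simp]: "sets lam = sets borel"
    and lam_null: "emeasure lam {..0} = 0"
    and lam_Ioc: "0 < x \<Longrightarrow> x \<le> y \<Longrightarrow> emeasure lam {x<..y} = ennreal (h x - h y)"
begin

lemma space_lam [simp]: "space lam = UNIV"
  using sets_eq_imp_space_eq[OF sets_lam] by simp

text \<open>Let the right end of \<open>{x<..y}\<close> tend to infinity, where \<open>h\<close>
  vanishes.\<close>

lemma lam_tail:
  assumes "x > 0" shows "emeasure lam {x<..} = ennreal (h x)"
proof -
  have "(\<lambda>n. emeasure lam {x<..x + real n}) \<longlonglongrightarrow> emeasure lam (\<Union>n. {x<..x + real n})"
    by (intro Lim_emeasure_incseq) (auto simp: incseq_def)
  also have "(\<Union>n. {x<..x + real n}) = {x<..}"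
    using real_arch_simple[of "_ - x"] by (fastforce simp: algebra_simps)
  finally have "(\<lambda>n. ennreal (h x - h (x + real n))) \<longlonglongrightarrow> emeasure lam {x<..}"
    using assms by (simp add: lam_Ioc)
  moreover have "(\<lambda>n. ennreal (h x - h (x + real n))) \<longlonglongrightarrow> ennreal (h x - 0)"
    by (intro tendsto_ennrealI tendsto_intros filterlim_compose[OF lim_top]
        filterlim_tendsto_add_at_top[OF tendsto_const] filterlim_real_sequentially)
  ultimately show ?thesis
    by (auto dest: LIMSEQ_unique)
qed

text \<open>Needed for Tonelli's theorem. The total mass may be infinite near 0, but the tails from
  \<open>1 / real (Suc n)\<close> on are finite, and \<open>{..0}\<close> is null.\<close>

sublocale sigma_finite_measure lam
proof
  define A where "A = insert {..0} (range (\<lambda>n. {1 / real (Suc n)<..}))"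
  have "x \<in> \<Union>A" for x
  proof (cases "x \<le> 0")
    case False
    then obtain n where "1 / real (Suc n) < x"
      using reals_Archimedean[of x] by (auto simp: inverse_eq_divide)
    then show ?thesis by (auto simp: A_def)
  qed (auto simp: A_def)
  then show "\<exists>A. countable A \<and> A \<subseteq> sets lam \<and> \<Union>A = space lam \<and> (\<forall>a\<in>A. emeasure lam a \<noteq> \<infinity>)"
    by (intro exI[of _ A]) (auto simp: A_def lam_null lam_tail)
qed

lemma measurable_indicator_h [measurable]: "(\<lambda>t. h t * indicator {0<..} t) \<in> borel_measurable borel"
  using borel_measurable_continuous_on_indicator[OF _ cont] by (simp add: mult.commute)

text \<open>Integration by parts, in the form of Tonelli's theorem for \<open>{(t, x). 0 < t < x}\<close>.\<close>
lemma nn_integral_lam_primitive: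
  fixes g :: "real \<Rightarrow> ennreal"
  assumes [measurable]: "g \<in> borel_measurable borel"
  shows "(\<integral>\<^sup>+x. (\<integral>\<^sup>+t. g t * indicator {0<..<x} t \<partial>lborel) \<partial>lam)
       = (\<integral>\<^sup>+t. g t * ennreal (h t * indicator {0<..} t) \<partial>lborel)"
proof -
  interpret pair_sigma_finite lborel lam
    by unfold_locales
  have "(\<integral>\<^sup>+x. (\<integral>\<^sup>+t. g t * indicator {0<..<x} t \<partial>lborel) \<partial>lam)
      = (\<integral>\<^sup>+x. (\<integral>\<^sup>+t. g t * (if 0 < t \<and> t < x then 1 else 0) \<partial>lborel) \<partial>lam)"
    by (intro nn_integral_cong) (auto split: split_indicator)
  also have "\<dots> = (\<integral>\<^sup>+t. (\<integral>\<^sup>+x. g t * (if 0 < t \<and> t < x then 1 else 0) \<partial>lam) \<partial>lborel)"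
    by (rule Fubini') measurable
  also have "\<dots> = (\<integral>\<^sup>+t. g t * ennreal (h t * indicator {0<..} t) \<partial>lborel)"
  proof (rule nn_integral_cong)
    fix t :: real
    have "(\<integral>\<^sup>+x. g t * (if 0 < t \<and> t < x then 1 else 0) \<partial>lam)
        = (\<integral>\<^sup>+x. (g t * indicator {0<..} t) * indicator {t<..} x \<partial>lam)"
      by (intro nn_integral_cong) (auto split: split_indicator)
    also have "\<dots> = (g t * indicator {0<..} t) * emeasure lam {t<..}"
      by (rule nn_integral_cmult_indicator) simp
    also have "\<dots> = g t * ennreal (h t * indicator {0<..} t)"
      by (auto simp: lam_tail split: split_indicator)
    finally show "(\<integral>\<^sup>+x. g t * (if 0 < t \<and> t < x then 1 else 0) \<partial>lam) = g t * ennreal (h t * indicator {0<..} t)" .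
  qed
  finally show ?thesis .
qed

lemma AE_lam_pos: "AE x in lam. x > 0"
  using lam_null by (subst AE_iff_measurable[of "{..0}"]) auto

text \<open>For \<open>x > 0\<close>, \<open>min x 1\<close> is the integral of the indicator of
  \<open>{0<..1}\<close> up to \<open>x\<close>, so integration by parts turns its integral into
  that of \<open>h\<close> over \<open>{0<..1}\<close>.\<close>

lemma integrable_min: "integrable lam (\<lambda>x. min x 1)"
proof (rule integrableI_bounded)
  have "(\<integral>\<^sup>+x. ennreal (norm (min x 1)) \<partial>lam)
      = (\<integral>\<^sup>+x. (\<integral>\<^sup>+t. indicator {0<..1} t * indicator {0<..<x} t \<partial>lborel) \<partial>lam)"
  proof (intro nn_integral_cong_AE, use AE_lam_pos in eventually_elim)
    case (elim x)
    have "(\<integral>\<^sup>+t. indicator {0<..1} t * indicator {0<..<x} t \<partial>lborel) = emeasure lborel ({0<..1} \<inter> {0<..<x})"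
      by (simp flip: nn_integral_indicator indicator_inter_arith)
    also have "{0<..1} \<inter> {0<..<x} = (if x \<le> 1 then {0<..<x} else {0<..1})"
      by auto
    finally show ?case
      using elim by (auto simp: min_def)
  qed
  also have "\<dots> = (\<integral>\<^sup>+t. indicator {0<..1} t * ennreal (h t * indicator {0<..} t) \<partial>lborel)"
    by (rule nn_integral_lam_primitive) simp
  also have "\<dots> = (\<integral>\<^sup>+x\<in>{0<..1}. ennreal (h x) \<partial>lborel)"
    by (intro nn_integral_cong) (auto split: split_indicator)
  finally show "(\<integral>\<^sup>+x. ennreal (norm (min x 1)) \<partial>lam) < \<infinity>"
    using int_small by simp
qed simp

lemma one_minus_exp_le_min:
  fixes x :: real
  assumes "s > 0" "x > 0"
  shows "0 \<le> 1 - exp (- s * x)" "1 - exp (- s * x) \<le> max s 1 * min x 1"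
proof -
  show "0 \<le> 1 - exp (- s * x)"
    using assms by simp
  have "1 - exp (- s * x) \<le> s * x"
    using exp_ge_add_one_self[of "- s * x"] by simp
  also have "\<dots> \<le> max s 1 * x"
    using assms by (intro mult_right_mono) auto
  finally have "1 - exp (- s * x) \<le> max s 1 * x" .
  moreover have "1 - exp (- s * x) \<le> max s 1 * 1"
    by (rule order_trans[of _ 1]) simp_all
  ultimately show "1 - exp (- s * x) \<le> max s 1 * min x 1"
    by (simp add: min_def)
qed

lemma integrable_one_minus_exp:
  assumes "s > 0" shows "integrable lam (\<lambda>x. 1 - exp (- s * x))"
proof (rule Bochner_Integration.integrable_bound)
  show "integrable lam (\<lambda>x. max s 1 * min x 1)"
    by (intro integrable_mult_right integrable_min)
  show "AE x in lam. norm (1 - exp (- s * x)) \<le> norm (max s 1 * min x 1)"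
    using AE_lam_pos
  proof eventually_elim
    case (elim x)
    with one_minus_exp_le_min[OF assms this] show ?case by simp
  qed
qed simp

section \<open>The Laplace transform of the tail\<close>

definition laplace :: "real \<Rightarrow> real" where
  "laplace s = (\<integral>t. exp (- s * t) * (h t * indicator {0<..} t) \<partial>lborel)"

text \<open>\<open>1 - exp (- s * x)\<close> is the primitive of \<open>s * exp (- s * t)\<close>
  that vanishes at 0. With extended nonnegative integrals on the right, finiteness of the Laplace
  transform becomes a conclusion.\<close>

lemma nn_integral_laplace:
  assumes s: "s > 0"
  shows "ennreal (\<integral>x. (1 - exp (- s * x)) \<partial>lam)
       = ennreal s * (\<integral>\<^sup>+t. ennreal (exp (- s * t) * (h t * indicator {0<..} t)) \<partial>lborel)"
proof -
  have "ennreal (\<integral>x. (1 - exp (- s * x)) \<partial>lam) = (\<integral>\<^sup>+x. ennreal (1 - exp (- s * x)) \<partial>lam)"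
    using AE_lam_pos s
    by (intro nn_integral_eq_integral[symmetric] integrable_one_minus_exp) (auto elim!: eventually_mono)
  also have "\<dots> = (\<integral>\<^sup>+x. (\<integral>\<^sup>+t. ennreal (s * exp (- s * t)) * indicator {0<..<x} t \<partial>lborel) \<partial>lam)"
  proof (intro nn_integral_cong_AE, use AE_lam_pos in eventually_elim)
    case (elim x)
    have "(\<integral>\<^sup>+t. ennreal (s * exp (- s * t)) * indicator {0<..<x} t \<partial>lborel)
        = (\<integral>\<^sup>+t. ennreal (s * exp (- s * t)) * indicator {0..x} t \<partial>lborel)"
    proof (rule nn_integral_cong_AE)
      show "AE t in lborel. ennreal (s * exp (- s * t)) * indicator {0<..<x} t
          = ennreal (s * exp (- s * t)) * indicator {0..x} t"
        using AE_lborel_singleton[of 0] AE_lborel_singleton[of x]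
        by eventually_elim (auto split: split_indicator)
    qed
    also have "\<dots> = ennreal (- exp (- s * x) - - exp (- s * 0))"
      using elim s by (intro nn_integral_FTC_Icc) (auto intro!: derivative_eq_intros)
    finally show ?case by simp
  qed
  also have "\<dots> = (\<integral>\<^sup>+t. ennreal (s * exp (- s * t)) * ennreal (h t * indicator {0<..} t) \<partial>lborel)"
    by (rule nn_integral_lam_primitive) simp
  also have "\<dots> = (\<integral>\<^sup>+t. ennreal s * ennreal (exp (- s * t) * (h t * indicator {0<..} t)) \<partial>lborel)"
    using s pos by (intro nn_integral_cong) (auto simp: ennreal_mult[symmetric] less_imp_le mult_ac split: split_indicator)
  also have "\<dots> = ennreal s * (\<integral>\<^sup>+t. ennreal (exp (- s * t) * (h t * indicator {0<..} t)) \<partial>lborel)"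
    by (rule nn_integral_cmult) simp
  finally show ?thesis .
qed

lemma laplace_nonneg_integrand: "0 \<le> exp (- s * t) * (h t * indicator {0<..} t)"
  using pos by (auto simp: less_imp_le split: split_indicator)

lemma integrable_laplace:
  assumes s: "s > 0"
  shows "integrable lborel (\<lambda>t. exp (- s * t) * (h t * indicator {0<..} t))"
proof (rule integrableI_nonneg)
  \<comment> \<open>The product of this integral with \<open>s > 0\<close> is the
    \<open>ennreal\<close> of a real number, hence finite.\<close>
  show "(\<integral>\<^sup>+t. ennreal (exp (- s * t) * (h t * indicator {0<..} t)) \<partial>lborel) < \<infinity>"
    using nn_integral_laplace[OF s] s
    by (metis ennreal_less_top ennreal_mult_eq_top_iff ennreal_eq_0_iff infinity_ennreal_def less_top linorder_not_le)
qed (use laplace_nonneg_integrand in auto)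

lemma nn_integral_eq_laplace:
  assumes "s > 0"
  shows "(\<integral>\<^sup>+t. ennreal (exp (- s * t) * (h t * indicator {0<..} t)) \<partial>lborel) = ennreal (laplace s)"
  unfolding laplace_def
  by (rule nn_integral_eq_integral[OF integrable_laplace[OF assms]]) (use laplace_nonneg_integrand in auto)

lemma laplace_nonneg: "0 \<le> laplace s"
  unfolding laplace_def using laplace_nonneg_integrand by (intro integral_nonneg_AE) auto

lemma laplace_pos:
  assumes s: "s > 0" shows "0 < laplace s"
proof -
  have "0 < (\<integral>t. exp (- s * 1) * h 1 * indicator {0<..1} t \<partial>(lborel :: real measure))"
    using pos[of 1] by simp
  also have "\<dots> \<le> laplace s"
    unfolding laplace_def
  proof (rule integral_mono[OF _ integrable_laplace[OF s]])
    show "exp (- s * 1) * h 1 * indicator {0<..1} t \<le> exp (- s * t) * (h t * indicator {0<..} t)" for t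
    proof (cases "t \<in> {0<..1}")
      case True
      have "exp (- s * 1) * h 1 \<le> exp (- s * t) * h t"
        using True s pos[of 1] antimono[of t 1] by (intro mult_mono) auto
      then show ?thesis using True by simp
    next
      case False
      then show ?thesis using laplace_nonneg_integrand[of s t] by simp
    qed
  qed simp
  finally show ?thesis .
qed

lemma integral_one_minus_exp:
  assumes s: "s > 0" shows "(\<integral>x. (1 - exp (- s * x)) \<partial>lam) = s * laplace s"
proof -
  have "ennreal (\<integral>x. (1 - exp (- s * x)) \<partial>lam) = ennreal (s * laplace s)"
    using s by (simp only: nn_integral_laplace[OF s] nn_integral_eq_laplace[OF s])
      (simp add: ennreal_mult laplace_nonneg)
  moreover have "0 \<le> (\<integral>x. (1 - exp (- s * x)) \<partial>lam)"
    using AE_lam_pos s by (intro integral_nonneg_AE) (auto elim!: eventually_mono)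
  ultimately show ?thesis
    using s laplace_nonneg by simp
qed

text \<open>Truncate at some \<open>n\<close> with the integral of \<open>h\<close> up to
  \<open>n\<close> above twice the target. Once \<open>s\<close> is so small that
  \<open>exp (- s * n) > 1/2\<close>, the Laplace transform keeps at least half of it.\<close>

lemma laplace_at_right_0:
  assumes inf: "(\<integral>\<^sup>+x\<in>{0<..}. ennreal (h x) \<partial>lborel) = \<infinity>"
  shows "filterlim laplace at_top (at_right 0)"
  unfolding filterlim_at_top
proof
  fix K :: real
  have "(SUP n. \<integral>\<^sup>+t. ennreal (h t * indicator {0<..} t) * indicator {..real n} t \<partial>lborel)
      = (\<integral>\<^sup>+t. (SUP n. ennreal (h t * indicator {0<..} t) * indicator {..real n} t) \<partial>lborel)"
    by (intro nn_integral_monotone_convergence_SUP[symmetric])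
      (auto simp: incseq_def le_fun_def split: split_indicator)
  also have "\<dots> = (\<integral>\<^sup>+x\<in>{0<..}. ennreal (h x) \<partial>lborel)"
  proof (rule nn_integral_cong)
    fix t :: real
    obtain m :: nat where m: "t \<le> real m"
      using real_arch_simple by blast
    show "(SUP n. ennreal (h t * indicator {0<..} t) * indicator {..real n} t) = ennreal (h t) * indicator {0<..} t"
    proof (rule antisym)
      show "ennreal (h t) * indicator {0<..} t \<le> (SUP n. ennreal (h t * indicator {0<..} t) * indicator {..real n} t)"
        by (rule SUP_upper2[of m]) (use m in \<open>auto split: split_indicator\<close>)
    qed (auto intro!: SUP_least split: split_indicator)
  qed
  finally have "(SUP n. \<integral>\<^sup>+t. ennreal (h t * indicator {0<..} t) * indicator {..real n} t \<partial>lborel) = \<infinity>"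
    using inf by simp
  \<comment> \<open>The factor 2 pays for the later bound \<open>1/2\<close>; \<open>max 0 K\<close>
    keeps the target nonnegative, as products under \<open>ennreal\<close> require.\<close>
  with ennreal_less_top[of "2 * max 0 K"] have "ennreal (2 * max 0 K) < (SUP n. \<integral>\<^sup>+t. ennreal (h t * indicator {0<..} t) * indicator {..real n} t \<partial>lborel)"
    by (simp only: infinity_ennreal_def)
  then obtain n :: nat
    where n: "ennreal (2 * max 0 K) < (\<integral>\<^sup>+t. ennreal (h t * indicator {0<..} t) * indicator {..real n} t \<partial>lborel)"
    by (auto simp: less_SUP_iff)
  have "((\<lambda>s. exp (- s * real n)) \<longlongrightarrow> exp (- 0 * real n)) (at_right 0)"
    by (intro tendsto_intros)
  then have "\<forall>\<^sub>F s in at_right 0. exp (- s * real n) > 1/2"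
    by (rule order_tendstoD) simp
  moreover have "\<forall>\<^sub>F s in at_right (0::real). s > 0"
    by (auto simp: eventually_at_filter)
  ultimately show "\<forall>\<^sub>F s in at_right 0. K \<le> laplace s"
  proof eventually_elim
    case (elim s)
    have "ennreal (1/2) * ennreal (2 * max 0 K)
        \<le> ennreal (1/2) * (\<integral>\<^sup>+t. ennreal (h t * indicator {0<..} t) * indicator {..real n} t \<partial>lborel)"
      using n by (intro mult_left_mono) auto
    also have "\<dots> = (\<integral>\<^sup>+t. ennreal (1/2) * (ennreal (h t * indicator {0<..} t) * indicator {..real n} t) \<partial>lborel)"
      by (rule nn_integral_cmult[symmetric]) simp
    also have "\<dots> \<le> (\<integral>\<^sup>+t. ennreal (exp (- s * t) * (h t * indicator {0<..} t)) \<partial>lborel)"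
    proof (rule nn_integral_mono)
      fix t :: real
      show "ennreal (1/2) * (ennreal (h t * indicator {0<..} t) * indicator {..real n} t)
          \<le> ennreal (exp (- s * t) * (h t * indicator {0<..} t))"
      proof (cases "0 < t \<and> t \<le> real n")
        case True
        have "exp (- s * real n) \<le> exp (- s * t)"
          using True elim by simp
        then have "1/2 * h t \<le> exp (- s * t) * h t"
          using elim pos[of t] True by (intro mult_right_mono) (linarith, simp)
        then have "ennreal (1/2) * ennreal (h t) \<le> ennreal (exp (- s * t) * h t)"
          using pos[of t] True by (subst ennreal_mult[symmetric]) (auto intro: ennreal_leI)
        then show ?thesis
          using True by simp
      qed (auto split: split_indicator)
    qed
    also have "\<dots> = ennreal (laplace s)"
      using elim by (intro nn_integral_eq_laplace) auto
    also have "ennreal (1/2) * ennreal (2 * max 0 K) = ennreal (max 0 K)"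
      by (subst ennreal_mult[symmetric]) auto
    finally have "ennreal (max 0 K) \<le> ennreal (laplace s)" .
    then show ?case
      using laplace_nonneg[of s] by (simp add: ennreal_le_iff)
  qed
qed

section \<open>Riemann sums and power series approximating the Laplace transform\<close>

lemma summable_riemann_laplace:
  assumes s: "s > 0" and d: "d > 0"
  shows "summable (\<lambda>n. d * (exp (- s * (real (Suc n) * d)) * h (real (Suc n) * d)))"
proof (rule summable_mult, rule summable_comparison_test')
  show "summable (\<lambda>n. h d * exp (- s * d) ^ Suc n)"
    using s d by (intro summable_mult) (simp add: summable_geometric summable_mult)
  fix n :: nat assume "n \<ge> 0"
  have "d \<le> real (Suc n) * d"
    using d by simp
  then have "h (real (Suc n) * d) \<le> h d" "h (real (Suc n) * d) > 0"
    using d by (auto intro: antimono pos)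
  moreover have "exp (- s * (real (Suc n) * d)) = exp (- s * d) ^ Suc n"
    by (simp only: exp_of_nat_mult[symmetric]) (simp add: algebra_simps)
  ultimately show "norm (exp (- s * (real (Suc n) * d)) * h (real (Suc n) * d)) \<le> h d * exp (- s * d) ^ Suc n"
    by (simp add: abs_mult mult_ac mult_mono)
qed

text \<open>The integrand \<open>F\<close> decreases on the positive axis, so the step function
  \<open>G k\<close> taking its value at the right end of each cell stays below \<open>F\<close>.
  This holds even if \<open>F\<close> is unbounded near 0, and \<open>F\<close> serves as the
  majorant for dominated convergence.\<close>

lemma riemann_sums_laplace:
  assumes s: "s > 0" and d: "\<And>k. d k > 0" "d \<longlonglongrightarrow> 0"
  shows "(\<lambda>k. \<Sum>n. d k * (exp (- s * (real (Suc n) * d k)) * h (real (Suc n) * d k))) \<longlonglongrightarrow> laplace s"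
proof -
  define F where "F t = exp (- s * t) * (h t * indicator {0<..} t)" for t
  have [measurable]: "F \<in> borel_measurable borel"
    unfolding F_def by measurable
  have F0: "F t \<ge> 0" for t
    unfolding F_def by (rule laplace_nonneg_integrand)
  have Fmono: "F y \<le> F x" if "0 < x" "x \<le> y" for x y
    using that s antimono[of x y] pos[of y] by (auto simp: F_def intro!: mult_mono)
  \<comment> \<open>The right end of the mesh cell that contains \<open>t\<close>.\<close>
  define c where "c k t = of_int \<lceil>t / d k\<rceil> * d k" for k and t :: real
  have c: "t \<le> c k t" "c k t \<le> t + d k" for k t
    using mult_right_mono[OF le_of_int_ceiling[of "t / d k"], of "d k"]
      mult_right_mono[OF of_int_ceiling_le_add_one[of "t / d k"], of "d k"] d(1)[of k]
    by (simp_all add: c_def distrib_right)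
  define G where "G k t = F (c k t) * indicator {0<..} t" for k t
  have [measurable]: "G k \<in> borel_measurable borel" for k
    unfolding G_def c_def by measurable
  have G: "0 \<le> G k t" "G k t \<le> F t" for k t
    using F0 Fmono[of t "c k t"] c(1)[of t k] by (auto simp: G_def split: split_indicator)
  have F_int: "integrable lborel F"
    unfolding F_def by (rule integrable_laplace[OF s])
  have G_int: "integrable lborel (G k)" for k
    by (rule Bochner_Integration.integrable_bound[OF F_int]) (use G F0 in auto)
  have "(\<integral>\<^sup>+t. ennreal (G k t) \<partial>lborel) = (\<Sum>n. ennreal (d k * F (real (Suc n) * d k)))" for k
  proof -
    have "ennreal (G k t) = (\<Sum>n. ennreal (F (real (Suc n) * d k)) * indicator {real n * d k<..real (Suc n) * d k} t)" for t
    proof (cases "t > 0")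
      case False
      then have "t \<notin> {real n * d k<..real (Suc n) * d k}" for n
        using d(1)[of k] by (auto simp: not_less intro: order_trans[of t 0])
      then show ?thesis using False by (simp add: G_def)
    next
      case True
      \<comment> \<open>The index of the cell of \<open>t\<close>: cells are open on the left and
        closed on the right, so the ceiling of \<open>t / d k\<close> is
        \<open>Suc m\<close>.\<close>
      define m where "m = nat (\<lceil>t / d k\<rceil> - 1)"
      have "\<lceil>t / d k\<rceil> \<ge> 1"
        using True d(1)[of k] by (simp add: one_le_ceiling)
      then have m: "real_of_int \<lceil>t / d k\<rceil> = real (Suc m)"
        unfolding m_def by (simp add: of_nat_diff)
      have mem: "t \<in> {real n * d k<..real (Suc n) * d k} \<longleftrightarrow> n = m" for n
      proof -
        have "t \<in> {real n * d k<..real (Suc n) * d k} \<longleftrightarrow> real n < t / d k \<and> t / d k \<le> real (Suc n)"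
          using d(1)[of k] by (auto simp: field_simps)
        also have "\<dots> \<longleftrightarrow> \<lceil>t / d k\<rceil> = int (Suc n)"
          by (auto simp: ceiling_eq_iff)
        also have "\<dots> \<longleftrightarrow> n = m"
          using m by linarith
        finally show ?thesis .
      qed
      have "(\<Sum>n. ennreal (F (real (Suc n) * d k)) * indicator {real n * d k<..real (Suc n) * d k} t)
          = (\<Sum>n\<in>{m}. ennreal (F (real (Suc n) * d k)) * indicator {real n * d k<..real (Suc n) * d k} t)"
        by (rule suminf_finite) (use mem in \<open>auto simp del: greaterThanAtMost_iff\<close>)
      also have "\<dots> = ennreal (F (real (Suc m) * d k))"
        using mem[of m] by (simp del: greaterThanAtMost_iff)
      finally show ?thesis
        using True by (simp add: G_def c_def m)
    qed
    then have "(\<integral>\<^sup>+t. ennreal (G k t) \<partial>lborel)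
        = (\<Sum>n. \<integral>\<^sup>+t. ennreal (F (real (Suc n) * d k)) * indicator {real n * d k<..real (Suc n) * d k} t \<partial>lborel)"
      by (simp only:) (rule nn_integral_suminf, simp)
    also have "\<dots> = (\<Sum>n. ennreal (d k * F (real (Suc n) * d k)))"
      using d(1)[of k] F0
      by (intro suminf_cong, subst nn_integral_cmult_indicator)
        (auto simp: algebra_simps ennreal_mult[symmetric])
    finally show ?thesis .
  qed
  moreover have "(\<integral>\<^sup>+t. ennreal (G k t) \<partial>lborel) = ennreal (\<integral>t. G k t \<partial>lborel)" for k
    using G by (intro nn_integral_eq_integral G_int) auto
  ultimately have sum_eq: "(\<Sum>n. ennreal (d k * F (real (Suc n) * d k))) = ennreal (\<integral>t. G k t \<partial>lborel)" for k
    by simp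
  have dF: "0 \<le> d k * F (real (Suc n) * d k)" for k n
    using d(1)[of k] F0 by simp
  have dF_eq: "d k * F (real (Suc n) * d k) = d k * (exp (- s * (real (Suc n) * d k)) * h (real (Suc n) * d k))" for k n
    using d(1)[of k] by (simp add: F_def)
  have summ: "summable (\<lambda>n. d k * F (real (Suc n) * d k))" for k
    unfolding dF_eq by (rule summable_riemann_laplace[OF s d(1)])
  have "ennreal (\<Sum>n. d k * F (real (Suc n) * d k)) = ennreal (\<integral>t. G k t \<partial>lborel)" for k
    using suminf_ennreal2[OF dF summ] sum_eq by simp
  then have "(\<Sum>n. d k * F (real (Suc n) * d k)) = (\<integral>t. G k t \<partial>lborel)" for k
    using suminf_nonneg[OF summ dF] G by (simp add: integral_nonneg_AE)
  moreover have "(\<lambda>k. \<integral>t. G k t \<partial>lborel) \<longlonglongrightarrow> (\<integral>t. F t \<partial>lborel)"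
  proof (rule integral_dominated_convergence[OF _ _ F_int])
    show "AE t in lborel. (\<lambda>k. G k t) \<longlonglongrightarrow> F t"
    proof (rule AE_I2)
      fix t :: real
      show "(\<lambda>k. G k t) \<longlonglongrightarrow> F t"
      proof (cases "t > 0")
        case True
        have "(\<lambda>k. c k t) \<longlonglongrightarrow> t"
          by (rule tendsto_sandwich[of "\<lambda>_. t" _ _ "\<lambda>k. t + d k"])
            (use c tendsto_add[OF tendsto_const[of t] d(2)] in auto)
        moreover have "isCont F t"
        proof -
          have "continuous_on {0<..} (\<lambda>t. exp (- s * t) * h t)"
            by (intro continuous_intros cont)
          then have "continuous_on {0<..} F"
            by (rule continuous_on_eq) (simp add: F_def)
          then show ?thesis
            using True by (simp add: continuous_on_eq_continuous_at)
        qed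
        ultimately have "(\<lambda>k. F (c k t)) \<longlonglongrightarrow> F t"
          by (rule isCont_tendsto_compose[rotated])
        then show ?thesis using True by (simp add: G_def)
      qed (simp add: G_def F_def)
    qed
    show "AE t in lborel. norm (G k t) \<le> F t" for k
      using G by auto
  qed auto
  ultimately show "(\<lambda>k. \<Sum>n. d k * (exp (- s * (real (Suc n) * d k)) * h (real (Suc n) * d k))) \<longlonglongrightarrow> laplace s"
    by (simp only: dF_eq[symmetric] laplace_def F_def[symmetric])
qed

text \<open>The sampling points start at \<open>d\<close>, the exponents at 0; the factor
  \<open>exp (s * d)\<close> corrects this shift by one, and \<open>b\<close> is absorbed by the
  constant coefficient.\<close>

lemma riemann_power_series:
  assumes s: "s > 0" and d: "d > 0"
  shows "(\<lambda>n. (d * h (real (Suc n) * d) + (if n = 0 then b else 0)) * exp (- s * d) ^ n) sums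
    (b + exp (s * d) * (\<Sum>n. d * (exp (- s * (real (Suc n) * d)) * h (real (Suc n) * d))))"
proof -
  define R where "R n = d * (exp (- s * (real (Suc n) * d)) * h (real (Suc n) * d))" for n
  have "summable R"
    unfolding R_def by (rule summable_riemann_laplace[OF s d])
  then have "(\<lambda>n. (if n = 0 then b else 0) + exp (s * d) * R n) sums (b + exp (s * d) * suminf R)"
    by (intro sums_add sums_mult summable_sums) (use sums_single[of 0 "\<lambda>_. b"] in simp_all)
  also have "(\<lambda>n. (if n = 0 then b else 0) + exp (s * d) * R n)
      = (\<lambda>n. (d * h (real (Suc n) * d) + (if n = 0 then b else 0)) * exp (- s * d) ^ n)"
  proof
    fix n
    have "exp (s * d) * exp (- s * (real (Suc n) * d)) = exp (- s * d) ^ n"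
      by (simp flip: exp_add exp_of_nat_mult add: algebra_simps)
    then have "exp (s * d) * R n = d * h (real (Suc n) * d) * exp (- s * d) ^ n"
      by (simp add: R_def mult_ac)
    then show "(if n = 0 then b else 0) + exp (s * d) * R n
        = (d * h (real (Suc n) * d) + (if n = 0 then b else 0)) * exp (- s * d) ^ n"
      by (simp add: algebra_simps)
  qed
  finally show ?thesis
    unfolding R_def .
qed

end

section \<open>The reciprocal of the Laplace transform\<close>

context decreasing_tail
begin

lemma bernstein_reciprocal_laplace:
  assumes lc: "log_convex_pos h" and b: "b \<ge> 0"
    and phi: "\<And>s. s > 0 \<Longrightarrow> \<phi> s = 1 / (b + laplace s)"
    and phi0: "\<phi> 0 = 0" and lim: "(\<phi> \<longlongrightarrow> 0) (at_right 0)"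
  shows "bernstein \<phi>"
proof -
  define d where "d k = 1 / real (Suc k)" for k
  have d: "d k > 0" for k
    by (simp add: d_def)
  have d_lim: "d \<longlonglongrightarrow> 0"
    unfolding d_def using LIMSEQ_inverse_real_of_nat by (simp only: inverse_eq_divide)
  define u where "u k n = d k * h (real (Suc n) * d k) + (if n = 0 then b else 0)" for k n
  define R where "R k s = (\<Sum>n. d k * (exp (- s * (real (Suc n) * d k)) * h (real (Suc n) * d k)))" for k s
  \<comment> \<open>The reciprocal of the power series with coefficients \<open>u k\<close> at
    \<open>z = exp (- s * d k)\<close>.\<close>
  define \<phi>k where "\<phi>k k s = 1 / (b + exp (s * d k) * R k s)" for k s
  have h_pos: "h (real (Suc n) * d k) > 0" for n k
    using d[of k] by (intro pos) simp
  have u_pos: "u k n > 0" for k n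
    unfolding u_def using h_pos[of n k] d[of k] b by (intro add_pos_nonneg mult_pos_pos) auto
  have u_lc: "(u k (Suc n))\<^sup>2 \<le> u k n * u k (Suc (Suc n))" for k n
  proof -
    have mid: "(real (Suc n) * d k + real (Suc (Suc (Suc n))) * d k) / 2 = real (Suc (Suc n)) * d k"
      by (simp add: field_simps)
    have "(h (real (Suc (Suc n)) * d k))\<^sup>2 \<le> h (real (Suc n) * d k) * h (real (Suc (Suc (Suc n))) * d k)"
      unfolding mid[symmetric] using d[of k] by (intro log_convex_pos_midpoint[OF lc]) auto
    \<comment> \<open>The coefficients at \<open>Suc n\<close> and \<open>Suc (Suc n)\<close>
      contain no \<open>b\<close>, so this is the midpoint inequality scaled by the square of
      \<open>d k\<close>. Adding \<open>b\<close> to the coefficient 0 afterwards can only enlarge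
      the right-hand side.\<close>
    then have "(u k (Suc n))\<^sup>2 \<le> (d k * h (real (Suc n) * d k)) * u k (Suc (Suc n))"
      using d[of k] by (simp add: u_def power2_eq_square mult_ac)
    also have "\<dots> \<le> u k n * u k (Suc (Suc n))"
      using b u_pos[of k "Suc (Suc n)"] by (intro mult_right_mono) (auto simp: u_def)
    finally show ?thesis .
  qed
  have u_sums: "(\<lambda>n. u k n * exp (- s * d k) ^ n) sums (b + exp (s * d k) * R k s)" if "s > 0" for k s
    unfolding u_def R_def by (rule riemann_power_series[OF that d])
  have "\<exists>p. (\<forall>n. p n \<ge> 0) \<and> (\<forall>z. 0 < z \<longrightarrow> z < 1 \<longrightarrow>
      (\<lambda>n. if n = 0 then p 0 else p n * (1 - z ^ n)) sums (1 / (\<Sum>n. u k n * z ^ n)))" for k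
  proof -
    have summ: "summable (\<lambda>n. u k n * z ^ n)" if z: "0 < z" "z < 1" for z
    proof -
      \<comment> \<open>Every \<open>z\<close> in (0, 1) is \<open>exp (- s * d k)\<close> for this
        positive \<open>s\<close>, so convergence of the series follows from that of the Riemann
        sums.\<close>
      define s where "s = - ln z / d k"
      have "s > 0" "z = exp (- s * d k)"
        using z d[of k] by (simp_all add: s_def divide_neg_pos)
      then show ?thesis
        using u_sums[of s k] by (simp add: sums_iff)
    qed
    obtain p :: "nat \<Rightarrow> real" where "\<And>n. p n \<ge> 0"
      and "\<And>z. 0 < z \<Longrightarrow> z < 1 \<Longrightarrow>
          (\<lambda>n. if n = 0 then p 0 else p n * (1 - z ^ n)) sums (1 / (\<Sum>n. u k n * z ^ n))"
      using kaluza_reciprocal[of "u k", OF u_pos u_lc summ] by blast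
    then show ?thesis by blast
  qed
  then obtain p where p: "\<And>k n. p k n \<ge> 0"
    and p_sums: "\<And>k z. 0 < z \<Longrightarrow> z < 1 \<Longrightarrow>
      (\<lambda>n. if n = 0 then p k 0 else p k n * (1 - z ^ n)) sums (1 / (\<Sum>n. u k n * z ^ n))"
    by metis
  show ?thesis
  proof (rule bernstein_limit[of p d \<phi>k \<phi>, OF p d _ _ _ _ phi0 lim])
    fix s :: real and k assume s: "s > 0"
    have "exp (- s * d k) < 1"
      using s d[of k] by simp
    from p_sums[OF exp_gt_zero this]
    show "(\<lambda>n. if n = 0 then p k 0 else p k n * (1 - exp (- s * d k) ^ n)) sums \<phi>k k s"
      using u_sums[OF s, of k] by (simp add: \<phi>k_def sums_iff)
  next
    fix s :: real assume s: "s > 0"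
    have "(\<lambda>k. R k s) \<longlonglongrightarrow> laplace s"
      unfolding R_def by (rule riemann_sums_laplace[OF s d d_lim])
    \<comment> \<open>The correction factor \<open>exp (s * d k)\<close> tends to 1 with the
      mesh.\<close>
    then have "(\<lambda>k. \<phi>k k s) \<longlonglongrightarrow> 1 / (b + exp (s * 0) * laplace s)"
      unfolding \<phi>k_def using b laplace_pos[OF s] by (intro tendsto_intros d_lim) auto
    then show "(\<lambda>k. \<phi>k k s) \<longlonglongrightarrow> \<phi> s"
      using phi[OF s] by simp
  next
    fix k
    have "0 < (\<Sum>n. u k n * exp (- 1 * d k) ^ n)"
      using u_sums[of 1 k] u_pos by (intro suminf_pos) (auto simp: sums_iff)
    then show "0 < \<phi>k k 1"
      using u_sums[of 1 k] by (simp add: \<phi>k_def sums_iff)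
  next
    show "0 < \<phi> 1"
      using phi[of 1] b laplace_pos[of 1] by simp
  qed
qed

end

section \<open>Membership of \<open>\<Psi>\<close> and its conjugate in the Bernstein class\<close>

theorem theorem2p7:
  shows "Lambda_set \<subseteq> Sigma_set"
proof
  fix \<Psi> assume "\<Psi> \<in> Lambda_set"
  then obtain b h lam where b: "b \<ge> 0" and lc: "log_convex_pos h"
    and anti: "\<forall>x y. 0 < x \<longrightarrow> x \<le> y \<longrightarrow> h y \<le> h x"
    and int1: "(\<integral>\<^sup>+x\<in>{0<..1}. ennreal (h x) \<partial>lborel) < \<infinity>"
    and inf: "(\<integral>\<^sup>+x\<in>{0<..}. ennreal (h x) \<partial>lborel) = \<infinity>"
    and top: "(h \<longlongrightarrow> 0) at_top"
    and lam: "sets lam = sets borel" "emeasure lam {..0} = 0"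
      "\<forall>x y. 0 < x \<longrightarrow> x \<le> y \<longrightarrow> emeasure lam {x<..y} = ennreal (h x - h y)"
    and Psi: "\<forall>s\<ge>0. \<Psi> s = b * s + (\<integral>x. (1 - exp (- s * x)) \<partial>lam)"
    unfolding Lambda_set_def by blast
  interpret decreasing_tail h lam
    using anti lc log_convex_pos_continuous_on[OF lc] int1 top lam
    by unfold_locales (auto simp: log_convex_pos_def)
  \<comment> \<open>\<open>b\<close> and \<open>lam\<close> themselves are the drift and the
    measure; the integrability condition is \<open>integrable_min\<close>.\<close>
  have "bernstein \<Psi>"
    unfolding bernstein_def using b lam Psi integrable_min by blast
  have Psi_eq: "\<Psi> s = s * (b + laplace s)" if "s > 0" for s
    using Psi that integral_one_minus_exp[OF that] by (simp add: distrib_left mult.commute)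
  have "\<Psi> 1 \<noteq> 0"
    using b laplace_pos[of 1] by (simp add: Psi_eq)
  have ratio: "s / \<Psi> s = 1 / (b + laplace s)" if "s > 0" for s
    using that by (simp add: Psi_eq)
  have lim: "((\<lambda>s. 1 / (b + laplace s)) \<longlongrightarrow> 0) (at_right 0)"
    by (intro real_tendsto_divide_at_top[OF tendsto_const]
        filterlim_tendsto_add_at_top[OF tendsto_const] laplace_at_right_0[OF inf])
  have ev: "\<forall>\<^sub>F s in at_right 0. 1 / (b + laplace s) = s / \<Psi> s"
    using ratio by (auto simp: eventually_at_filter)
  have lim': "((\<lambda>s. s / \<Psi> s) \<longlongrightarrow> 0) (at_right 0)"
    by (rule Lim_transform_eventually[OF lim ev])
  \<comment> \<open>The conjugate is defined at 0 by this limit. Its being 0 gives both the value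
    and the right-hand continuity at 0 that exclude a constant term.\<close>
  then have "Lim (at_right 0) (\<lambda>s. s / \<Psi> s) = 0"
    by (intro tendsto_Lim) auto
  moreover have "(bstar \<Psi> \<longlongrightarrow> 0) (at_right 0)"
    by (rule Lim_transform_eventually[OF lim']) (auto simp: eventually_at_filter bstar_def)
  ultimately have "bernstein (bstar \<Psi>)"
    by (intro bernstein_reciprocal_laplace[OF lc b]) (simp_all add: bstar_def ratio)
  then show "\<Psi> \<in> Sigma_set"
    unfolding Sigma_set_def using \<open>bernstein \<Psi>\<close> \<open>\<Psi> 1 \<noteq> 0\<close> by (auto intro: exI[of _ 1])
qed

end
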